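(* Let $h(x) = c_0 + c_1 x + \cdots + c_n x^n \in \mathbb{R}_n[x]$ be a polynomial with nonnegative coefficients, let $f(x) = \sum_{i=0}^n c_i x^i (1+x)^{n-i}$, and for a positive integer $r$ define $\mathcal{D}_{n,r}(h(x)) \in \mathbb{R}_n[x]$ by \[ f(0) + \sum_{m \ge 1} \left( f(rm) - f(rm-1) \right) x^m = \frac{\mathcal{D}_{n,r}(h(x))}{(1-x)^n}. \] (a) The polynomial $\mathcal{D}_{n,r}(h(x))$ is real-rooted. (b) If $c_0 + c_1 + \cdots + c_i \le c_n + c_{n-1} + \cdots + c_{n-i}$ for all $0 \le i \le \lfloor n/2 \rfloor$, then $\mathcal{D}_{n,r}(h(x))$ has a nonnegative, real-rooted symmetric decomposition with respect to $n$.
   Context: $\mathbb{R}_n[x]$ denotes the space of real polynomials of degree at most $n$. A polynomial is real-rooted if all its roots are real or it is identically zero. Every $p(x)\in\mathbb{R}_m[x]$ can be written uniquely as $p(x)=a(x)+x\,b(x)$ with $a(x)=x^m a(1/x)$ and $b(x)=x^{m-1}b(1/x)$; this is the symmetric decomposition of $p$ with respect to $m$. It is called nonnegative (resp. real-rooted) if both $a(x)$ and $b(x)$ have nonnegative coefficients (resp. are real-rooted). *)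

theory Defs
  imports Complex_Main "HOL-Computational_Algebra.Computational_Algebra"
begin

definition real_rooted :: "real poly \<Rightarrow> bool" where
  "real_rooted p \<longleftrightarrow>
     p = 0 \<or> (\<forall>z::complex. poly (map_poly complex_of_real p) z = 0 \<longrightarrow> z \<in> \<real>)"

definition nonneg_coeffs :: "real poly \<Rightarrow> bool" where
  "nonneg_coeffs p \<longleftrightarrow> (\<forall>i. coeff p i \<ge> 0)"

text \<open>
  The identity \<open>p(x) = x^k p(1/x)\<close>, stated at all nonzero real points. The exponent is an
  integer, so that the case \<open>k = -1\<close> (arising for the second component of a decomposition with
  respect to \<open>0\<close>) has its usual meaning; it then forces \<open>p = 0\<close>.
\<close>

definition self_reciprocal :: "int \<Rightarrow> real poly \<Rightarrow> bool" where
  "self_reciprocal k p \<longleftrightarrow> (\<forall>x. x \<noteq> 0 \<longrightarrow> poly p x = x powi k * poly p (1 / x))"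

definition symmetric_decomposition ::
    "nat \<Rightarrow> real poly \<Rightarrow> real poly \<Rightarrow> real poly \<Rightarrow> bool" where
  "symmetric_decomposition m p a b \<longleftrightarrow>
     p = a + [:0, 1:] * b \<and> self_reciprocal (int m) a \<and> self_reciprocal (int m - 1) b"

lemma poly_eq_off_zeroI:
  fixes p q :: "real poly"
  assumes "\<And>x. x \<noteq> 0 \<Longrightarrow> x \<noteq> 1 \<Longrightarrow> poly p x = poly q x"
  shows "p = q"
proof -
  have "[:0, 1:] * [:-1, 1:] * p = [:0, 1:] * [:-1, 1:] * q"
  proof (rule poly_ext)
    fix x
    show "poly ([:0, 1:] * [:-1, 1:] * p) x = poly ([:0, 1:] * [:-1, 1:] * q) x"
      using assms[of x] by (cases "x = 0 \<or> x = 1") auto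
  qed
  then show ?thesis
    by (simp del: mult_pCons_left mult_pCons_right)
qed

lemma symmetric_decomposition_unique:
  assumes "symmetric_decomposition m p a b" "symmetric_decomposition m p a' b'"
  shows "a = a' \<and> b = b'"
proof -
  have *: "poly p x - x ^ m * poly p (1 / x) = (x - 1) * poly b x"
    if "symmetric_decomposition m p a b" "x \<noteq> 0" for a b x
  proof -
    have p: "p = a + [:0, 1:] * b" and a: "poly a x = x ^ m * poly a (1 / x)"
      and b: "poly b x = x powi (int m - 1) * poly b (1 / x)"
      using that unfolding symmetric_decomposition_def self_reciprocal_def power_int_of_nat
      by blast+
    have "x ^ m * poly p (1 / x) = x ^ m * poly a (1 / x) + x ^ m / x * poly b (1 / x)"
      by (simp add: p algebra_simps)
    also have "x ^ m / x = x powi (int m - 1)"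
      using \<open>x \<noteq> 0\<close> by (simp add: power_int_diff)
    finally show ?thesis
      using a b by (simp add: p algebra_simps)
  qed
  have "b = b'"
  proof (rule poly_eq_off_zeroI)
    fix x :: real
    assume "x \<noteq> 0" "x \<noteq> 1"
    then show "poly b x = poly b' x"
      using *[OF assms(1), of x] *[OF assms(2), of x] by simp
  qed
  then show ?thesis
    using assms by (auto simp: symmetric_decomposition_def)
qed

lemma symmetric_decomposition_exists:
  assumes "degree p \<le> m"
  shows "\<exists>a b. symmetric_decomposition m p a b"
proof -
  define q where "q = (\<Sum>i\<le>m. monom (coeff p i) (m - i))"
  have q: "poly q x = x ^ m * poly p (1 / x)" if "x \<noteq> 0" for x
  proof -
    have "poly p (1 / x) = (\<Sum>i\<le>m. coeff p i * (1 / x) ^ i)"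
      unfolding poly_altdef
      by (rule sum.mono_neutral_left) (use assms in \<open>auto simp: coeff_eq_0\<close>)
    then show ?thesis
      using that
      by (auto simp: q_def poly_sum poly_monom sum_distrib_left power_diff field_simps
          intro!: sum.cong)
  qed
  have qinv: "x ^ m * poly q (1 / x) = poly p x" if "x \<noteq> 0" for x
    using that q[of "1 / x"] by (simp add: power_one_over)
  have "poly (p - q) 1 = 0"
    using q[of 1] by simp
  then obtain b where b: "p - q = [:-1, 1:] * b"
    unfolding poly_eq_0_iff_dvd by auto
  define a where "a = q - b"
  have pq: "poly p x - poly q x = (x - 1) * poly b x" for x
    using arg_cong[OF b, of "\<lambda>p. poly p x"] by (simp add: algebra_simps)
  have pab: "p = a + [:0, 1:] * b"
    by (rule poly_ext) (use pq in \<open>simp add: a_def algebra_simps\<close>)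
  have sb: "poly b x = x powi (int m - 1) * poly b (1 / x)" if "x \<noteq> 0" for x
  proof (cases "x = 1")
    case False
    have "(1 / x - 1) * (x ^ m * poly b (1 / x)) = x ^ m * poly p (1 / x) - x ^ m * poly q (1 / x)"
      unfolding right_diff_distrib[symmetric] pq by (simp add: mult_ac)
    also have "\<dots> = (1 - x) * poly b x"
      using q[OF that] qinv[OF that] pq[of x] by (simp add: algebra_simps)
    also have "\<dots> = (1 / x - 1) * (x * poly b x)"
      using that by (simp add: field_simps)
    finally have "x ^ m * poly b (1 / x) = x * poly b x"
      using False that by (subst (asm) mult_cancel_left) (auto simp: field_simps)
    then show ?thesis
      using that by (simp add: power_int_diff field_simps)
  qed auto
  have sa: "poly a x = x ^ m * poly a (1 / x)" if "x \<noteq> 0" for x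
  proof -
    have "x ^ m * poly b (1 / x) = x * poly b x"
      using sb[OF that] that by (simp add: power_int_diff field_simps)
    then show ?thesis
      using qinv[OF that] pq[of x] by (simp add: a_def algebra_simps)
  qed
  show ?thesis
    using pab sa sb unfolding symmetric_decomposition_def self_reciprocal_def power_int_of_nat by blast
qed

definition h_to_f :: "nat \<Rightarrow> real poly \<Rightarrow> real poly" where
  "h_to_f n h = (\<Sum>i\<le>n. monom (coeff h i) i * [:1, 1:] ^ (n - i))"

definition D_series :: "nat \<Rightarrow> nat \<Rightarrow> real poly \<Rightarrow> real fps" where
  "D_series n r h = Abs_fps (\<lambda>m.
     if m = 0 then poly (h_to_f n h) 0
     else poly (h_to_f n h) (real (r * m)) - poly (h_to_f n h) (real (r * m) - 1))"

definition D_op :: "nat \<Rightarrow> nat \<Rightarrow> real poly \<Rightarrow> real poly" where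
  "D_op n r h =
     (THE D. degree D \<le> n \<and> D_series n r h = fps_of_poly D / (1 - fps_X) ^ n)"

lemma degree_h_to_f: "degree (h_to_f n h) \<le> n"
  unfolding h_to_f_def
proof (rule degree_sum_le, simp)
  fix i assume "i \<in> {..n}"
  have "degree (monom (coeff h i) i * [:1, 1:] ^ (n - i))
      \<le> degree (monom (coeff h i) i) + degree ([:1, 1::real:] ^ (n - i))"
    by (rule degree_mult_le)
  also have "\<dots> \<le> i + (n - i)"
    by (intro add_mono degree_monom_le) (simp add: degree_linear_power)
  finally show "degree (monom (coeff h i) i * [:1, 1:] ^ (n - i)) \<le> n"
    using \<open>i \<in> {..n}\<close> by simp
qed

lemma backward_difference_degree:
  fixes p :: "real poly"
  assumes "degree p \<le> n"
  shows "p - pcompose p [:-1, 1:] = 0 \<or> degree (p - pcompose p [:-1, 1:]) < n"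
proof (cases "degree p = 0")
  case True
  then show ?thesis
    by (auto elim!: degree_eq_zeroE simp: pcompose_pCons)
next
  case False
  define q where "q = pcompose p [:-1, 1:]"
  have dq: "degree q = degree p"
    by (simp add: q_def degree_pcompose)
  have "lead_coeff q = lead_coeff p"
    unfolding q_def by (subst lead_coeff_comp) auto
  then have 0: "coeff (p - q) (degree p) = 0"
    by (simp add: dq)
  have "degree (p - q) \<le> degree p"
    by (rule degree_diff_le) (auto simp: dq)
  moreover have "degree (p - q) \<noteq> degree p \<or> p - q = 0"
    using 0 by (metis leading_coeff_0_iff)
  ultimately show ?thesis
    using assms unfolding q_def by linarith
qed

lemma eventually_poly_series_coeff_0:
  fixes A :: "real fps"
  assumes "\<And>m. m \<ge> N \<Longrightarrow> fps_nth A m = poly g (real m)" "g = 0 \<or> degree g < n" "k \<ge> N + n"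
  shows "fps_nth (A * (1 - fps_X) ^ n) k = 0"
  using assms
proof (induction n arbitrary: A g N)
  case 0
  then show ?case by simp
next
  case (Suc n)
  define g' where "g' = g - pcompose g [:-1, 1:]"
  have "fps_nth (A * (1 - fps_X)) m = poly g' (real m)" if "m \<ge> Suc N" for m
  proof -
    define l where "l = m - 1"
    have l: "m = Suc l" "l \<ge> N"
      using that unfolding l_def by linarith+
    have "fps_nth (A * (1 - fps_X)) m = fps_nth A m - fps_nth A l"
      by (simp add: l(1) right_diff_distrib)
    also have "\<dots> = poly g (real m) - poly g (real l)"
      using Suc.prems(1)[of l] Suc.prems(1)[of m] l by simp
    also have "\<dots> = poly g' (real m)"
      by (simp add: g'_def poly_pcompose l(1))
    finally show ?thesis .
  qed
  moreover have "g' = 0 \<or> degree g' < n"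
    using backward_difference_degree[of g n] Suc.prems(2) by (auto simp: g'_def)
  ultimately have "fps_nth (A * (1 - fps_X) * (1 - fps_X) ^ n) k = 0"
    using Suc.prems(3) by (intro Suc.IH[of "Suc N" _ g']) auto
  then show ?case
    by (simp add: mult.assoc)
qed

lemma D_op_ex1:
  "\<exists>!D. degree D \<le> n \<and> D_series n r h = fps_of_poly D / (1 - fps_X) ^ n"
proof -
  define U :: "real fps" where "U = (1 - fps_X) ^ n"
  have U0: "U \<noteq> 0" and U_unit: "is_unit U"
    by (auto simp: U_def fps_is_unit_iff fps_nth_power_0 dest: arg_cong[of _ _ "\<lambda>f. fps_nth f 0"])
  have div_iff: "A = B / U \<longleftrightarrow> A * U = B" for A B :: "real fps"
    using U0 U_unit by (metis dvd_div_mult_self nonzero_mult_div_cancel_right unit_imp_dvd)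
  define q where "q = h_to_f n h - pcompose (h_to_f n h) [:-1, 1:]"
  define g where "g = pcompose q [:0, real r:]"
  have "q = 0 \<or> degree q < n"
    using backward_difference_degree[OF degree_h_to_f] by (simp add: q_def)
  moreover have "degree g \<le> degree q"
    by (cases "r = 0") (auto simp: g_def degree_pcompose)
  ultimately have g: "g = 0 \<or> degree g < n"
    by (auto simp: g_def)
  have "fps_nth (D_series n r h) m = poly g (real m)" if "m \<ge> 1" for m
    using that by (simp add: D_series_def g_def q_def poly_pcompose algebra_simps)
  then have 0: "fps_nth (D_series n r h * U) k = 0" if "k \<ge> 1 + n" for k
    unfolding U_def using g that by (rule eventually_poly_series_coeff_0)
  define D where "D = (\<Sum>i\<le>n. monom (fps_nth (D_series n r h * U) i) i)"
  have cD: "coeff D k = fps_nth (D_series n r h * U) k" for k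
    using 0[of k] by (auto simp: D_def coeff_sum)
  have "degree D \<le> n"
    by (rule degree_le) (use 0 in \<open>auto simp: cD\<close>)
  moreover have "D_series n r h * U = fps_of_poly D"
    by (rule fps_ext) (simp add: cD)
  ultimately show ?thesis
    unfolding U_def[symmetric] div_iff by (metis fps_of_poly_eq_iff)
qed

end

theory Submission
  imports Defs
begin

text \<open>
  The coefficients of \<open>x\<^sup>m\<close> in the series \<open>(1 - x) \<Sum>\<^sub>m m\<^sup>i (m + 1)\<^sup>n\<^sup>-\<^sup>i x\<^sup>m\<close>, split by residue
  classes of \<open>m\<close> modulo \<open>r\<close>, give \<open>N = r (n + 1)\<close> polynomials \<open>f\<^sub>0, \<dots>, f\<^sub>N\<^sub>-\<^sub>1\<close> over \<open>(1 - x)\<^sup>n\<close>; the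
  first \<open>n + 1\<close> of them belong to residue \<open>0\<close>, so that \<open>D\<^sub>n\<^sub>,\<^sub>r(h) = \<Sum> c\<^sub>i f\<^sub>i\<close>. Translating the argument
  by \<open>r\<close> multiplies a series by \<open>x\<close>, which extends the family to all indices by \<open>f\<^sub>p\<^sub>+\<^sub>N = x f\<^sub>p\<close>. The
  members for \<open>n + 1\<close> are then the sums \<open>f\<^sub>t + \<dots> + f\<^sub>t\<^sub>+\<^sub>N\<^sub>-\<^sub>1\<close> over windows of one period, and
  passing to window sums preserves the property that \<open>f\<^sub>p\<close> interlaces \<open>f\<^sub>q\<close> for \<open>p \<le> q \<le> p + N\<close>.
  Part (a) follows.

  For part (b) let \<open>f\<close> be the family for \<open>n - 1\<close>. It satisfies the reflection
  \<open>x\<^sup>n\<^sup>-\<^sup>1\<^sup>+\<^sup>a f\<^sub>p(1/x) = f\<^sub>a\<^sub>N\<^sub>+\<^sub>n\<^sub>-\<^sub>1\<^sub>-\<^sub>p(x)\<close>, so a sum of \<open>f\<^sub>p\<close> over \<open>i \<le> p < aN + n - i\<close> is self-reciprocal.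
  Recentering the windows that make up \<open>D\<^sub>n\<^sub>,\<^sub>r(h)\<close> gives \<open>a = \<Sum> c\<^sub>i (f\<^sub>i + \<dots> + f\<^sub>N\<^sub>+\<^sub>n\<^sub>-\<^sub>i\<^sub>-\<^sub>1)\<close> and
  \<open>b = \<Sum> (c\<^sub>n\<^sub>-\<^sub>i - c\<^sub>i) (f\<^sub>i + \<dots> + f\<^sub>n\<^sub>-\<^sub>i\<^sub>-\<^sub>1)\<close> over \<open>i \<le> n/2\<close>, and the hypothesis on \<open>c\<close> says that the
  weight of each \<open>f\<^sub>p\<close> in \<open>b\<close> is nonnegative.
\<close>

section \<open>Interlacing in the upper half-plane\<close>

abbreviation cpoly :: "real poly \<Rightarrow> complex \<Rightarrow> complex" where
  "cpoly p z \<equiv> poly (map_poly complex_of_real p) z"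

lemma cpoly_pCons: "cpoly (pCons c p) z = of_real c + z * cpoly p z"
  by (simp add: map_poly_pCons)

lemma cpoly_add: "cpoly (p + q) z = cpoly p z + cpoly q z"
  by (induction p q rule: poly_induct2) (simp_all add: cpoly_pCons algebra_simps)

lemma cpoly_smult: "cpoly (smult c p) z = of_real c * cpoly p z"
  by (induction p) (simp_all add: cpoly_pCons algebra_simps)

lemma cpoly_cnj: "cpoly p (cnj z) = cnj (cpoly p z)"
  by (simp add: poly_cnj_real coeff_map_poly)

definition upper_stable :: "real poly \<Rightarrow> bool" where
  "upper_stable p \<longleftrightarrow> (\<forall>z. Im z > 0 \<longrightarrow> cpoly p z = 0 \<longrightarrow> p = 0)"

lemma upper_stable_imp_real_rooted:
  assumes "upper_stable p"
  shows "real_rooted p"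
proof -
  have "z \<in> \<real>" if "p \<noteq> 0" "cpoly p z = 0" for z
  proof -
    have "Im z \<le> 0" "Im (cnj z) \<le> 0"
      using assms cpoly_cnj[of p z] that unfolding upper_stable_def
      by (metis complex_cnj_zero not_le)+
    then show ?thesis
      by (simp add: complex_is_Real_iff)
  qed
  then show ?thesis
    by (auto simp: real_rooted_def)
qed

lemma upper_stable_0 [simp]: "upper_stable 0"
  by (simp add: upper_stable_def)

lemma upper_stable_monom: "upper_stable (monom c k)"
  by (induction k) (auto simp: upper_stable_def cpoly_pCons monom_0 monom_Suc)

lemma upper_stable_smult: "upper_stable p \<Longrightarrow> upper_stable (smult c p)"
  by (auto simp: upper_stable_def cpoly_smult)

text \<open>
  For polynomials with nonnegative coefficients this is interlacing of zeros, phrased as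
  \<open>0 \<le> arg (g(z) / f(z)) \<le> arg z\<close> in the upper half-plane. In this form it is evidently closed
  under sums on either side, and pairwise relations suffice, so transitivity is never needed.
\<close>

definition interlaces :: "real poly \<Rightarrow> real poly \<Rightarrow> bool" (infix "\<lless>" 50) where
  "f \<lless> g \<longleftrightarrow> (\<forall>z. Im z > 0 \<longrightarrow>
     Im (cpoly g z * cnj (cpoly f z)) \<ge> 0 \<and> Im (z * cpoly f z * cnj (cpoly g z)) \<ge> 0)"

lemma upper_stable_add:
  assumes "f \<lless> g" "upper_stable f" "upper_stable g"
  shows "upper_stable (f + g)"
  unfolding upper_stable_def
proof (intro allI impI)
  fix z assume z: "Im z > 0" and "cpoly (f + g) z = 0"
  then have g: "cpoly g z = - cpoly f z"
    by (simp add: cpoly_add add_eq_0_iff)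
  have "Im (z * cpoly f z * cnj (cpoly g z)) \<ge> 0"
    using assms(1) z by (simp add: interlaces_def)
  then have "Im z * (norm (cpoly f z))\<^sup>2 \<le> 0"
    unfolding g by (simp add: cmod_def power2_eq_square algebra_simps)
  then have "cpoly f z = 0"
    using z by (simp add: mult_le_0_iff)
  then show "f + g = 0"
    using g assms(2,3) z by (auto simp: upper_stable_def)
qed

lemma interlaces_refl: "f \<lless> f"
proof -
  have "Im (z * cpoly f z * cnj (cpoly f z)) = Im z * (norm (cpoly f z))\<^sup>2" for z
    by (simp add: cmod_def power2_eq_square algebra_simps)
  then show ?thesis
    unfolding interlaces_def by simp
qed

lemma interlaces_0_left [simp]: "0 \<lless> f" and interlaces_0_right [simp]: "f \<lless> 0"
  by (simp_all add: interlaces_def)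

lemma interlaces_add_left: "f \<lless> h \<Longrightarrow> g \<lless> h \<Longrightarrow> f + g \<lless> h"
  unfolding interlaces_def cpoly_add complex_cnj_add distrib_left distrib_right plus_complex.sel
  by (metis add_nonneg_nonneg)

lemma interlaces_add_right: "f \<lless> g \<Longrightarrow> f \<lless> h \<Longrightarrow> f \<lless> g + h"
  unfolding interlaces_def cpoly_add complex_cnj_add distrib_left distrib_right plus_complex.sel
  by (metis add_nonneg_nonneg)

lemma interlaces_smult:
  assumes "f \<lless> g" "c \<ge> 0" "d \<ge> 0"
  shows "smult c f \<lless> smult d g"
  unfolding interlaces_def
proof (intro allI impI)
  fix z :: complex assume z: "Im z > 0"
  let ?F = "cpoly f z" and ?G = "cpoly g z"
  have "cpoly (smult d g) z * cnj (cpoly (smult c f) z) = (c * d) *\<^sub>R (?G * cnj ?F)"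
    "z * cpoly (smult c f) z * cnj (cpoly (smult d g) z) = (c * d) *\<^sub>R (z * ?F * cnj ?G)"
    by (simp_all add: cpoly_smult scaleR_conv_of_real mult_ac)
  then show "0 \<le> Im (cpoly (smult d g) z * cnj (cpoly (smult c f) z)) \<and>
      0 \<le> Im (z * cpoly (smult c f) z * cnj (cpoly (smult d g) z))"
    using assms z unfolding interlaces_def by (simp only: scaleR_complex.sel mult_nonneg_nonneg)
qed

lemma interlaces_pCons_0_right:
  assumes "f \<lless> g"
  shows "g \<lless> pCons 0 f"
  unfolding interlaces_def
proof (intro allI impI)
  fix z :: complex assume z: "Im z > 0"
  let ?F = "cpoly f z" and ?G = "cpoly g z"
  have "z * ?G * cnj (cpoly (pCons 0 f) z) = (norm z)\<^sup>2 *\<^sub>R (?G * cnj ?F)"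
    by (simp only: scaleR_conv_of_real complex_norm_square) (simp add: cpoly_pCons mult_ac)
  then have "Im (z * ?G * cnj (cpoly (pCons 0 f) z)) = (norm z)\<^sup>2 * Im (?G * cnj ?F)"
    by (simp only: scaleR_complex.sel)
  then show "0 \<le> Im (cpoly (pCons 0 f) z * cnj ?G) \<and> 0 \<le> Im (z * ?G * cnj (cpoly (pCons 0 f) z))"
    using assms z unfolding interlaces_def by (simp add: cpoly_pCons)
qed

lemma interlaces_exchange:
  assumes "m \<lless> u"
  shows "m + u \<lless> u + pCons 0 m"
  unfolding interlaces_def
proof (intro allI impI)
  fix z :: complex assume z: "Im z > 0"
  define U M where "U = cpoly u z" and "M = cpoly m z"
  have UM: "Im (U * cnj M) \<ge> 0" "Im (z * M * cnj U) \<ge> 0"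
    using assms z by (simp_all add: interlaces_def U_def M_def)
  have "Im ((U + z * M) * cnj (M + U)) =
      Im (U * cnj M) + Im (z * M * cnj U) + Im z * (norm M)\<^sup>2"
    by (simp add: cmod_def power2_eq_square algebra_simps)
  moreover have "Im (z * (M + U) * cnj (U + z * M)) =
      Im z * (norm U)\<^sup>2 + (norm z)\<^sup>2 * Im (U * cnj M) + Im (z * M * cnj U)"
    by (simp add: cmod_def power2_eq_square algebra_simps)
  ultimately show "0 \<le> Im (cpoly (u + pCons 0 m) z * cnj (cpoly (m + u) z)) \<and>
     0 \<le> Im (z * cpoly (m + u) z * cnj (cpoly (u + pCons 0 m) z))"
    using UM z by (simp add: cpoly_add cpoly_pCons U_def M_def)
qed

lemma interlaces_sum:
  assumes "\<And>i j. i \<in> A \<Longrightarrow> j \<in> B \<Longrightarrow> f i \<lless> g j"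
  shows "sum f A \<lless> sum g B"
proof -
  have "f i \<lless> sum g B" if "i \<in> A" for i
    using assms[OF that]
    by (induction B rule: infinite_finite_induct) (auto intro: interlaces_add_right)
  then show ?thesis
    by (induction A rule: infinite_finite_induct) (auto intro: interlaces_add_left)
qed

section \<open>Interlacing cycles\<close>

definition interlacing_cycle :: "nat \<Rightarrow> (nat \<Rightarrow> real poly) \<Rightarrow> bool" where
  "interlacing_cycle N f \<longleftrightarrow>
     (\<forall>p. upper_stable (f p)) \<and> (\<forall>p. f (p + N) = pCons 0 (f p)) \<and>
     (\<forall>p q. p \<le> q \<longrightarrow> q \<le> p + N \<longrightarrow> f p \<lless> f q)"

lemma interlacing_cycle_interlaces: "interlacing_cycle N f \<Longrightarrow> p \<le> q \<Longrightarrow> q \<le> p + N \<Longrightarrow> f p \<lless> f q"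
  by (simp add: interlacing_cycle_def)

lemma interlacing_cycle_comp:
  assumes f: "interlacing_cycle N f" and "mono t" and t: "\<And>q. t (q + M) = t q + N"
  shows "interlacing_cycle M (\<lambda>q. f (t q))"
proof -
  have "t p \<le> t q \<and> t q \<le> t p + N" if "p \<le> q" "q \<le> p + M" for p q
    using that \<open>mono t\<close> t[of p] by (metis monoD)
  then show ?thesis
    using f by (auto simp: interlacing_cycle_def t)
qed

lemma pCons_0_sum: "pCons 0 (sum f A) = (\<Sum>i\<in>A. pCons 0 (f i))"
  by (rule poly_eqI) (simp add: coeff_sum coeff_pCons split: nat.split)

lemma interlacing_cycle_sum_shift:
  assumes "interlacing_cycle N f"
  shows "(\<Sum>p=a+N..<b+N. f p) = pCons 0 (\<Sum>p=a..<b. f p)"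
  using assms by (simp add: sum.shift_bounds_nat_ivl pCons_0_sum interlacing_cycle_def)

lemma upper_stable_interlacing_cycle_combination:
  assumes f: "interlacing_cycle N f" and "b \<le> a + N" "\<And>p. a \<le> p \<Longrightarrow> p < b \<Longrightarrow> w p \<ge> 0"
  shows "upper_stable (\<Sum>p=a..<b. smult (w p) (f p))"
  using assms(2,3)
proof (induction b)
  case (Suc b)
  show ?case
  proof (cases "a \<le> b")
    case True
    have "(\<Sum>p=a..<b. smult (w p) (f p)) \<lless> (\<Sum>p\<in>{b}. smult (w p) (f p))"
      using True Suc.prems
      by (intro interlaces_sum interlaces_smult interlacing_cycle_interlaces[OF f]) auto
    moreover have "upper_stable (f b)"
      using f by (simp add: interlacing_cycle_def)
    ultimately show ?thesis
      using True Suc by (simp add: upper_stable_add upper_stable_smult)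
  qed simp
qed simp

lemma sum_smult_sum_swap:
  assumes "finite I" "finite B" "\<And>i. i \<in> I \<Longrightarrow> A i \<subseteq> B"
  shows "(\<Sum>i\<in>I. smult (c i) (\<Sum>p\<in>A i. f p)) = (\<Sum>p\<in>B. smult (\<Sum>i | i \<in> I \<and> p \<in> A i. c i) (f p))"
proof -
  have smult_sum_right: "smult a (sum f S) = (\<Sum>p\<in>S. smult a (f p))" for a and S
    by (induction S rule: infinite_finite_induct) (simp_all add: smult_add_right)
  have "{p \<in> B. p \<in> A i} = A i" if "i \<in> I" for i
    using assms(3)[OF that] by blast
  then have "(\<Sum>i\<in>I. smult (c i) (\<Sum>p\<in>A i. f p)) =
      (\<Sum>i\<in>I. \<Sum>p | p \<in> B \<and> p \<in> A i. smult (c i) (f p))"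
    by (simp add: smult_sum_right)
  also have "\<dots> = (\<Sum>p\<in>B. smult (\<Sum>i | i \<in> I \<and> p \<in> A i. c i) (f p))"
    by (simp add: sum.swap_restrict[OF assms(1,2)] smult_sum)
  finally show ?thesis .
qed

lemma upper_stable_interlacing_cycle_sums:
  assumes "interlacing_cycle N f" "finite I" "\<And>i. i \<in> I \<Longrightarrow> c i \<ge> 0" "\<And>i. i \<in> I \<Longrightarrow> A i \<subseteq> {a..<a+N}"
  shows "upper_stable (\<Sum>i\<in>I. smult (c i) (\<Sum>p\<in>A i. f p))"
proof -
  have "(\<Sum>i\<in>I. smult (c i) (\<Sum>p\<in>A i. f p)) =
      (\<Sum>p=a..<a+N. smult (\<Sum>i | i \<in> I \<and> p \<in> A i. c i) (f p))"
    using assms by (intro sum_smult_sum_swap) auto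
  also have "upper_stable \<dots>"
    using assms by (intro upper_stable_interlacing_cycle_combination sum_nonneg) auto
  finally show ?thesis .
qed

lemma interlacing_cycle_sums_interlace:
  assumes f: "interlacing_cycle N f"
    and "a \<le> b" "b \<le> c" "c \<le> a + N" "c \<le> d" "d \<le> b + N"
  shows "(\<Sum>p=a..<b. f p) \<lless> (\<Sum>p=c..<d. f p)"
proof (cases "d \<le> a + N")
  case True
  then show ?thesis
    using assms by (intro interlaces_sum interlacing_cycle_interlaces[OF f]) auto
next
  case False
  define e where "e = d - N"
  have e: "d = e + N" "a \<le> e" "e \<le> b"
    using False assms by (auto simp: e_def)
  let ?m = "\<Sum>p=a..<e. f p"
  have "(\<Sum>p=a..<b. f p) = ?m + (\<Sum>p=e..<b. f p)"
    using e by (simp add: sum.atLeastLessThan_concat)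
  moreover have "(\<Sum>p=c..<d. f p) = (\<Sum>p=c..<a+N. f p) + pCons 0 ?m"
    using assms e
    by (simp add: sum.atLeastLessThan_concat flip: interlacing_cycle_sum_shift[OF f])
  moreover have "?m \<lless> (\<Sum>p=c..<a+N. f p)" "(\<Sum>p=e..<b. f p) \<lless> (\<Sum>p=c..<a+N. f p)"
    "(\<Sum>p=e..<b. f p) \<lless> pCons 0 ?m"
    unfolding interlacing_cycle_sum_shift[OF f, symmetric] using assms e
    by (intro interlaces_sum interlacing_cycle_interlaces[OF f]; simp)+
  moreover have "?m \<lless> pCons 0 ?m"
    by (intro interlaces_pCons_0_right interlaces_refl)
  ultimately show ?thesis
    by (simp add: interlaces_add_left interlaces_add_right)
qed

definition window_sum :: "nat \<Rightarrow> (nat \<Rightarrow> real poly) \<Rightarrow> nat \<Rightarrow> real poly" where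
  "window_sum N f t = (\<Sum>p=t..<t+N. f p)"

lemma interlaces_window_sum:
  assumes f: "interlacing_cycle N f" and "s \<le> t" "t \<le> s + N"
  shows "window_sum N f s \<lless> window_sum N f t"
proof -
  let ?m = "\<Sum>p=s..<t. f p" and ?u = "\<Sum>p=t..<s+N. f p"
  have "?m \<lless> ?u"
    using assms by (intro interlaces_sum interlacing_cycle_interlaces[OF f]) auto
  moreover have "window_sum N f s = ?m + ?u"
    using assms by (simp add: window_sum_def sum.atLeastLessThan_concat)
  moreover have "window_sum N f t = ?u + pCons 0 ?m"
    using assms
    by (simp add: window_sum_def sum.atLeastLessThan_concat flip: interlacing_cycle_sum_shift[OF f])
  ultimately show ?thesis
    by (simp add: interlaces_exchange)
qed

lemma interlacing_cycle_window_sum: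
  assumes f: "interlacing_cycle N f"
  shows "interlacing_cycle N (window_sum N f)"
  unfolding interlacing_cycle_def
proof (intro conjI allI impI)
  show "upper_stable (window_sum N f t)" for t
    using upper_stable_interlacing_cycle_combination[OF f, of "t + N" t "\<lambda>_. 1"]
    by (simp add: window_sum_def)
  show "window_sum N f (t + N) = pCons 0 (window_sum N f t)" for t
    unfolding window_sum_def by (rule interlacing_cycle_sum_shift[OF f])
qed (rule interlaces_window_sum[OF f])

section \<open>Section polynomials\<close>

text \<open>
  The last position of each block of length \<open>m + 1\<close> is identified with the first one of the next,
  since \<open>x\<^sup>i (1 + x)\<^sup>m\<^sup>-\<^sup>i\<close> at \<open>i = m\<close> is the translate by \<open>1\<close> of the same expression at \<open>i = 0\<close>.
\<close>

definition contract :: "nat \<Rightarrow> nat \<Rightarrow> nat" where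
  "contract m q = q - q div Suc m"

lemma contract_block:
  assumes "i \<le> m"
  shows "contract m (c * Suc m + i) = c * m + i"
proof -
  have "(c * Suc m + i) div Suc m = c"
    using assms by (intro div_nat_eqI) auto
  then show ?thesis
    by (simp add: contract_def)
qed

lemma contract_eq_div_mod: "contract m q = q div Suc m * m + q mod Suc m"
  using contract_block[of "q mod Suc m" m "q div Suc m"] by (simp del: mult_Suc_right)

lemma contract_add: "contract m (q + c * Suc m) = contract m q + c * m"
  by (simp add: contract_eq_div_mod algebra_simps del: mult_Suc_right)

lemma mono_contract: "mono (contract m)"
  unfolding mono_iff_le_Suc by (auto simp: contract_def div_Suc intro: diff_le_mono)

lemma contract_diff:
  assumes "q \<le> c * Suc m + m"
  shows "contract m (c * Suc m + m - q) = c * m + m - contract m q"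
proof -
  define d i where "d = q div Suc m" and "i = q mod Suc m"
  have q: "q = d * Suc m + i" and i: "i \<le> m"
    by (simp_all add: d_def i_def flip: less_Suc_eq_le del: mult_Suc_right)
  have "d < Suc c"
    unfolding d_def using assms by (intro less_mult_imp_div_less) simp
  then obtain e where c: "c = d + e"
    using less_Suc_eq_le le_Suc_ex by blast
  have "c * Suc m + m - q = e * Suc m + (m - i)"
    using i by (simp add: q c algebra_simps)
  then show ?thesis
    using i by (simp only: q contract_block diff_le_self) (simp add: c algebra_simps)
qed

text \<open>
  With \<open>p = c (n + 1) + i\<close> and \<open>i \<le> n\<close>, the polynomial \<open>section_poly r n p\<close> is the numerator over
  \<open>(1 - x)\<^sup>n\<close> of the series of \<open>g (r m - c) - g (r m - c - 1)\<close>, where \<open>g(x) = x\<^sup>i (1 + x)\<^sup>n\<^sup>-\<^sup>i\<close>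
  for \<open>x \<ge> 0\<close> and \<open>g(x) = 0\<close> for \<open>x < 0\<close>.
\<close>

primrec section_poly :: "nat \<Rightarrow> nat \<Rightarrow> nat \<Rightarrow> real poly" where
  "section_poly r 0 = (\<lambda>p. if r dvd p then monom 1 (p div r) else 0)"
| "section_poly r (Suc n) = (\<lambda>q. window_sum (r * Suc n) (section_poly r n) (contract (Suc n) q))"

lemma interlacing_cycle_section_poly:
  assumes "r > 0"
  shows "interlacing_cycle (r * Suc n) (section_poly r n)"
proof (induction n)
  case 0
  have "section_poly r 0 p \<lless> section_poly r 0 q" if "p \<le> q" "q \<le> p + r" for p q
  proof (cases "r dvd p \<and> r dvd q")
    case True
    then obtain j l where "p = r * j" "q = r * l"
      by blast
    moreover from this that assms have "l = j \<or> l = Suc j"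
      by (metis le_SucE le_antisym mult_Suc_right add.commute nat_mult_le_cancel1)
    ultimately show ?thesis
      using assms by (auto simp: monom_Suc interlaces_refl interlaces_pCons_0_right)
  qed auto
  then show ?case
    using assms by (auto simp: interlacing_cycle_def upper_stable_monom monom_Suc)
next
  case (Suc n)
  show ?case
    unfolding section_poly.simps
    using interlacing_cycle_window_sum[OF Suc] mono_contract
    by (rule interlacing_cycle_comp) (metis contract_add mult.assoc)
qed

lemma upper_stable_section_poly_combination:
  assumes "r > 0" "\<And>i. i \<le> n \<Longrightarrow> c i \<ge> 0"
  shows "upper_stable (\<Sum>i\<le>n. smult (c i) (section_poly r n i))"
proof -
  have "Suc n \<le> r * Suc n"
    using assms(1) by (cases r) simp_all
  then show ?thesis
    using upper_stable_interlacing_cycle_combination[OF interlacing_cycle_section_poly[OF assms(1)],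
        of "Suc n" 0 n c] assms(2)
    by (simp add: atLeast0LessThan lessThan_Suc_atMost)
qed

lemma nonneg_coeffs_sum: "(\<And>i. i \<in> A \<Longrightarrow> nonneg_coeffs (f i)) \<Longrightarrow> nonneg_coeffs (sum f A)"
  by (simp add: nonneg_coeffs_def coeff_sum sum_nonneg)

lemma nonneg_coeffs_smult: "nonneg_coeffs p \<Longrightarrow> c \<ge> 0 \<Longrightarrow> nonneg_coeffs (smult c p)"
  by (simp add: nonneg_coeffs_def)

lemma nonneg_coeffs_section_poly: "nonneg_coeffs (section_poly r n p)"
proof (induction n arbitrary: p)
  case 0
  then show ?case by (simp add: nonneg_coeffs_def)
next
  case (Suc n)
  then show ?case
    by (simp add: window_sum_def nonneg_coeffs_sum)
qed

lemma section_poly_0_reciprocal: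
  assumes r: "r > 0" and x: "x \<noteq> 0" and p: "p \<le> a * r"
  shows "x ^ a * poly (section_poly r 0 p) (1 / x) = poly (section_poly r 0 (a * r - p)) x"
proof (cases "r dvd p")
  case True
  then obtain j where j: "p = r * j"
    by blast
  then have "j \<le> a"
    using p r by (simp add: mult.commute)
  then obtain b where a: "a = j + b"
    using le_Suc_ex by blast
  have "a * r - p = r * b"
    by (simp add: a j algebra_simps)
  then have "poly (section_poly r 0 (a * r - p)) x = x ^ b"
    using r by (simp add: poly_monom)
  moreover have "poly (section_poly r 0 p) (1 / x) = 1 / x ^ j"
    using r by (simp add: j poly_monom power_one_over)
  ultimately show ?thesis
    using x by (simp add: a power_add del: section_poly.simps)
next
  case False
  then show ?thesis
    using p by (auto dest: dvd_diffD1)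
qed

text \<open>
  The factor \<open>x\<^sup>a\<close> makes room for the part of a window that reflection carries below position \<open>0\<close>.
\<close>

lemma section_poly_reciprocal:
  assumes r: "r > 0" and x: "x \<noteq> 0" and "p \<le> a * (r * Suc n) + n"
  shows "x ^ (n + a) * poly (section_poly r n p) (1 / x) =
    poly (section_poly r n (a * (r * Suc n) + n - p)) x"
  using assms(3)
proof (induction n arbitrary: p a)
  case 0
  then show ?case
    using section_poly_0_reciprocal[OF r x] by simp
next
  case (Suc n)
  define N t e where "N = r * Suc n" and "t = contract (Suc n) p" and "e = a * N + Suc n"
  have e: "e = contract (Suc n) (a * (r * Suc (Suc n)) + Suc n)"
    using contract_block[of "Suc n" "Suc n" "a * r"]
    by (simp only: e_def N_def mult.assoc order.refl)
  have t: "t \<le> e"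
    unfolding t_def e using mono_contract Suc.prems by (rule monoD)
  have reflect: "contract (Suc n) (a * (r * Suc (Suc n)) + Suc n - p) = e - t"
    using contract_diff[of p "a * r" "Suc n"] Suc.prems
    by (simp only: e_def t_def N_def mult.assoc)
  have "x ^ (Suc n + a) * poly (section_poly r (Suc n) p) (1 / x) =
      (\<Sum>q=t..<t+N. x ^ (n + Suc a) * poly (section_poly r n q) (1 / x))"
    by (simp add: window_sum_def poly_sum sum_distrib_left N_def t_def)
  also have "\<dots> = (\<Sum>q=t..<t+N. poly (section_poly r n (e + N - Suc q)) x)"
  proof (intro sum.cong refl)
    fix q assume "q \<in> {t..<t+N}"
    then have "q \<le> Suc a * (r * Suc n) + n"
      using t by (simp add: e_def N_def)
    then show "x ^ (n + Suc a) * poly (section_poly r n q) (1 / x) =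
        poly (section_poly r n (e + N - Suc q)) x"
      using Suc.IH[of q "Suc a"] by (simp add: e_def N_def algebra_simps)
  qed
  also have "\<dots> = (\<Sum>q=e-t..<e-t+N. poly (section_poly r n q) x)"
    by (rule sum.reindex_bij_witness[of _ "\<lambda>q. e + N - Suc q" "\<lambda>q. e + N - Suc q"]) (use t in auto)
  also have "\<dots> = poly (section_poly r (Suc n) (a * (r * Suc (Suc n)) + Suc n - p)) x"
    by (simp only: section_poly.simps reflect window_sum_def poly_sum N_def)
  finally show ?case .
qed

section \<open>Generating functions\<close>

text \<open>
  Truncating at negative arguments makes the initial coefficient \<open>f(0)\<close> of the series a backward
  difference like all others.
\<close>

definition trunc_basis :: "nat \<Rightarrow> nat \<Rightarrow> int \<Rightarrow> real" where
  "trunc_basis n i t = (if t < 0 then 0 else of_int t ^ i * (1 + of_int t) ^ (n - i))"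

definition basis_diff :: "nat \<Rightarrow> nat \<Rightarrow> int \<Rightarrow> real" where
  "basis_diff n i t = trunc_basis n i t - trunc_basis n i (t - 1)"

lemma basis_diff_neg: "t < 0 \<Longrightarrow> basis_diff n i t = 0"
  by (simp add: basis_diff_def trunc_basis_def)

lemma basis_diff_step:
  assumes "i \<le> n"
  shows "basis_diff n i t = basis_diff (Suc n) i t - basis_diff (Suc n) (Suc i) t"
proof -
  have "trunc_basis n i t = trunc_basis (Suc n) i t - trunc_basis (Suc n) (Suc i) t" for t
    using assms by (simp add: trunc_basis_def Suc_diff_le algebra_simps)
  then show ?thesis by (simp add: basis_diff_def)
qed

lemma basis_diff_wrap: "basis_diff (Suc n) (Suc n) t = basis_diff (Suc n) 0 (t - 1)"
proof -
  have "trunc_basis (Suc n) (Suc n) t = trunc_basis (Suc n) 0 (t - 1)" for t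
    by (cases "t = 0") (auto simp: trunc_basis_def)
  then show ?thesis by (simp add: basis_diff_def)
qed

text \<open>
  For \<open>m = n + 1\<close> the position \<open>p\<close> has the same meaning as in \<open>section_poly r n\<close>; for \<open>m = n\<close> it is
  a position after contraction.
\<close>

definition section_fps :: "nat \<Rightarrow> nat \<Rightarrow> nat \<Rightarrow> nat \<Rightarrow> real fps" where
  "section_fps r n m p = Abs_fps (\<lambda>k. basis_diff n (p mod m) (int (r * k) - int (p div m)))"

lemma section_fps_step:
  "section_fps r n (Suc n) p =
     section_fps r (Suc n) (Suc n) p - section_fps r (Suc n) (Suc n) (Suc p)"
proof (rule fps_ext)
  fix k
  let ?t = "int (r * k) - int (p div Suc n)"
  have i: "p mod Suc n \<le> n"
    by (simp flip: less_Suc_eq_le)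
  have "basis_diff (Suc n) (Suc (p mod Suc n)) ?t =
      basis_diff (Suc n) (Suc p mod Suc n) (int (r * k) - int (Suc p div Suc n))"
    by (auto simp: mod_Suc div_Suc basis_diff_wrap algebra_simps)
  then show "fps_nth (section_fps r n (Suc n) p) k =
      fps_nth (section_fps r (Suc n) (Suc n) p - section_fps r (Suc n) (Suc n) (Suc p)) k"
    by (simp add: section_fps_def basis_diff_step[OF i])
qed

lemma section_fps_contract:
  "section_fps r (Suc n) (Suc n) (contract (Suc n) q) = section_fps r (Suc n) (Suc (Suc n)) q"
proof -
  define c i where "c = q div Suc (Suc n)" and "i = q mod Suc (Suc n)"
  have "i \<le> Suc n"
    by (simp add: i_def flip: less_Suc_eq_le)
  then consider "i < Suc n" | "i = Suc n"
    by linarith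
  then show ?thesis
  proof cases
    case 1
    then have "contract (Suc n) q div Suc n = c" "contract (Suc n) q mod Suc n = i"
      by (simp_all add: contract_eq_div_mod c_def i_def del: mult_Suc_right)
    then show ?thesis
      by (simp add: section_fps_def c_def i_def)
  next
    case 2
    then have "contract (Suc n) q = Suc c * Suc n"
      by (simp add: contract_eq_div_mod c_def i_def)
    then have "contract (Suc n) q div Suc n = Suc c" "contract (Suc n) q mod Suc n = 0"
      by (simp_all del: mult_Suc mult_Suc_right)
    then show ?thesis
      using 2 by (simp add: section_fps_def c_def i_def basis_diff_wrap algebra_simps)
  qed
qed

lemma section_fps_add:
  assumes "r > 0" "m > 0"
  shows "section_fps r n m (p + r * m) = fps_X * section_fps r n m p"
proof (rule fps_ext)
  fix k
  show "fps_nth (section_fps r n m (p + r * m)) k = fps_nth (fps_X * section_fps r n m p) k"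
    using assms by (cases k) (simp_all add: section_fps_def basis_diff_neg algebra_simps)
qed

lemma fps_of_poly_section_poly:
  assumes r: "r > 0"
  shows "fps_of_poly (section_poly r n p) = section_fps r n (Suc n) p * (1 - fps_X) ^ n"
proof (induction n arbitrary: p)
  case 0
  have "basis_diff 0 0 (int (r * k) - int p) = (if r dvd p \<and> k = p div r then 1 else 0)" for k
  proof -
    have "r dvd p \<and> k = p div r \<longleftrightarrow> int (r * k) - int p = 0"
      using r by (auto simp flip: of_nat_mult)
    then show ?thesis
      by (auto simp: basis_diff_def trunc_basis_def)
  qed
  then show ?case
    by (auto simp: section_fps_def fps_eq_iff)
next
  case (Suc n)
  define N t where "N = r * Suc n" and "t = contract (Suc n) p"
  define Q where "Q = section_fps r (Suc n) (Suc n)"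
  have "fps_of_poly (section_poly r (Suc n) p) = (\<Sum>q=t..<t+N. Q q - Q (Suc q)) * (1 - fps_X) ^ n"
    by (simp add: window_sum_def fps_of_poly_sum Suc section_fps_step sum_distrib_right
        Q_def N_def t_def)
  also have "(\<Sum>q=t..<t+N. Q q - Q (Suc q)) = Q t - Q (t + N)"
    using sum_Suc_diff'[of t "t + N" "\<lambda>q. - Q q"] by simp
  also have "Q (t + N) = fps_X * Q t"
    using r by (simp add: Q_def N_def section_fps_add del: mult_Suc_right)
  also have "(Q t - fps_X * Q t) * (1 - fps_X) ^ n = Q t * (1 - fps_X) ^ Suc n"
    by (simp add: algebra_simps)
  also have "Q t = section_fps r (Suc n) (Suc (Suc n)) p"
    unfolding Q_def t_def by (rule section_fps_contract)
  finally show ?case .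
qed

lemma poly_h_to_f: "poly (h_to_f n h) x = (\<Sum>i\<le>n. coeff h i * (x ^ i * (1 + x) ^ (n - i)))"
  by (simp add: h_to_f_def poly_sum poly_monom mult.assoc)

lemma D_series_eq_sum_section_fps:
  assumes "r > 0"
  shows "D_series n r h = (\<Sum>i\<le>n. fps_const (coeff h i) * section_fps r n (Suc n) i)"
proof (rule fps_ext)
  fix m
  have "fps_nth (D_series n r h) m = (\<Sum>i\<le>n. coeff h i * basis_diff n i (int (r * m)))"
  proof (cases "m = 0")
    case True
    then show ?thesis
      by (simp add: D_series_def poly_h_to_f basis_diff_def trunc_basis_def)
  next
    case False
    define T where "T = r * m"
    have "T > 0"
      using False assms by (simp add: T_def)
    then have "basis_diff n i (int T) =
        real T ^ i * (1 + real T) ^ (n - i) - (real T - 1) ^ i * (1 + (real T - 1)) ^ (n - i)" for i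
      by (simp add: basis_diff_def trunc_basis_def)
    then show ?thesis
      using False
      by (simp add: D_series_def poly_h_to_f T_def[symmetric] right_diff_distrib
          flip: sum_subtractf)
  qed
  also have "\<dots> = fps_nth (\<Sum>i\<le>n. fps_const (coeff h i) * section_fps r n (Suc n) i) m"
    by (simp add: fps_sum_nth section_fps_def)
  finally show "fps_nth (D_series n r h) m =
      fps_nth (\<Sum>i\<le>n. fps_const (coeff h i) * section_fps r n (Suc n) i) m" .
qed

lemma D_op_eq_sum_section_poly:
  assumes "r > 0"
  shows "D_op n r h = (\<Sum>i\<le>n. smult (coeff h i) (section_poly r n i))" (is "_ = ?D")
proof -
  let ?U = "(1 - fps_X :: real fps) ^ n"
  have U: "fps_nth ?U 0 \<noteq> 0"
    by (simp add: fps_nth_power_0)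
  have "D_series n r h = fps_of_poly (D_op n r h) / ?U"
    unfolding D_op_def using theI'[OF D_op_ex1] by blast
  then have "fps_of_poly (D_op n r h) = D_series n r h * ?U"
    using U by (simp add: fps_divide_unit mult.assoc inverse_mult_eq_1)
  also have "\<dots> = fps_of_poly ?D"
    using assms
    by (simp add: D_series_eq_sum_section_fps fps_of_poly_sum fps_of_poly_smult
        fps_of_poly_section_poly sum_distrib_right mult.assoc)
  finally show ?thesis
    by simp
qed

lemma real_rooted_D_op:
  assumes "r > 0" "nonneg_coeffs h"
  shows "real_rooted (D_op n r h)"
  unfolding D_op_eq_sum_section_poly[OF assms(1)] using assms
  by (intro upper_stable_imp_real_rooted upper_stable_section_poly_combination)
    (simp_all add: nonneg_coeffs_def)

section \<open>The symmetric decomposition\<close>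

lemma self_reciprocal_smult: "self_reciprocal k p \<Longrightarrow> self_reciprocal k (smult c p)"
  unfolding self_reciprocal_def by (metis poly_smult mult.left_commute)

lemma self_reciprocal_sum:
  "(\<And>i. i \<in> A \<Longrightarrow> self_reciprocal k (f i)) \<Longrightarrow> self_reciprocal k (sum f A)"
  unfolding self_reciprocal_def poly_sum sum_distrib_left by (intro allI impI sum.cong refl) blast

definition centered_sum :: "nat \<Rightarrow> nat \<Rightarrow> nat \<Rightarrow> nat \<Rightarrow> real poly" where
  "centered_sum r n a i = (\<Sum>p=i..<a * (r * Suc n) + Suc n - i. section_poly r n p)"

lemma self_reciprocal_centered_sum:
  assumes "r > 0"
  shows "self_reciprocal (int (n + a)) (centered_sum r n a i)"
  unfolding self_reciprocal_def power_int_of_nat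
proof (intro allI impI)
  fix x :: real assume "x \<noteq> 0"
  define L where "L = a * (r * Suc n) + n"
  have reflect: "x ^ (n + a) * poly (section_poly r n p) (1 / x) =
      poly (section_poly r n (L - p)) x" if "p \<le> L" for p
    using that unfolding L_def by (intro section_poly_reciprocal assms \<open>x \<noteq> 0\<close>)
  have "x ^ (n + a) * poly (centered_sum r n a i) (1 / x) =
      (\<Sum>p=i..<Suc L-i. x ^ (n + a) * poly (section_poly r n p) (1 / x))"
    by (simp add: centered_sum_def poly_sum sum_distrib_left L_def)
  also have "\<dots> = (\<Sum>p=i..<Suc L-i. poly (section_poly r n (L - p)) x)"
    by (intro sum.cong refl reflect) auto
  also have "\<dots> = (\<Sum>p=i..<Suc L-i. poly (section_poly r n p) x)"
    by (rule sum.reindex_bij_witness[of _ "\<lambda>p. L - p" "\<lambda>p. L - p"]) auto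
  finally show "poly (centered_sum r n a i) x = x ^ (n + a) * poly (centered_sum r n a i) (1 / x)"
    by (simp add: centered_sum_def poly_sum L_def)
qed

lemma window_sum_section_poly_eq_centered_sum:
  assumes r: "r > 0" and i: "i \<le> Suc n"
  shows "window_sum (r * Suc n) (section_poly r n) i = centered_sum r n 1 i +
    pCons 0 ((\<Sum>p<i. section_poly r n p) - (\<Sum>p<Suc n - i. section_poly r n p))"
proof -
  define N where "N = r * Suc n"
  have "Suc n \<le> N"
    using r by (cases r) (simp_all add: N_def)
  have split: "(\<Sum>p=i..<N+j. section_poly r n p) =
      (\<Sum>p=i..<N. section_poly r n p) + pCons 0 (\<Sum>p<j. section_poly r n p)" for j
  proof -
    have "(\<Sum>p=N..<N+j. section_poly r n p) = pCons 0 (\<Sum>p<j. section_poly r n p)"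
      using interlacing_cycle_sum_shift[OF interlacing_cycle_section_poly[OF r, of n], of 0 j]
      by (simp add: N_def lessThan_atLeast0 add.commute[of j] del: mult_Suc_right)
    then show ?thesis
      using i \<open>Suc n \<le> N\<close> sum.atLeastLessThan_concat[of i N "N + j" "section_poly r n"] by simp
  qed
  have "window_sum N (section_poly r n) i = (\<Sum>p=i..<N+i. section_poly r n p)"
    by (simp add: window_sum_def add.commute)
  moreover have "centered_sum r n 1 i = (\<Sum>p=i..<N+(Suc n-i). section_poly r n p)"
    using i by (simp add: centered_sum_def N_def)
  ultimately show ?thesis
    unfolding split N_def[symmetric] by simp
qed

lemma sum_smult_antisymmetric:
  fixes v :: "nat \<Rightarrow> real poly"
  assumes v: "\<And>i. i \<le> n \<Longrightarrow> v (n - i) = - v i"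
  shows "(\<Sum>i\<le>n. smult (c i) (v i)) = (\<Sum>i\<le>n div 2. smult (c i - c (n - i)) (v i))"
proof -
  have "(\<Sum>i\<le>n. smult (c i) (v i)) =
      (\<Sum>i\<le>n div 2. smult (c i) (v i)) + (\<Sum>i=Suc (n div 2)..n. smult (c i) (v i))"
    by (subst sum.union_disjoint[symmetric]) (auto intro!: sum.cong)
  also have "(\<Sum>i=Suc (n div 2)..n. smult (c i) (v i)) =
      (\<Sum>i<n - n div 2. smult (c (n - i)) (v (n - i)))"
    by (rule sum.reindex_bij_witness[of _ "\<lambda>i. n - i" "\<lambda>i. n - i"]) auto
  also have "\<dots> = (\<Sum>i\<le>n div 2. smult (c (n - i)) (v (n - i)))"
  proof (rule sum.mono_neutral_left)
    have "v i = 0" if "i \<in> {..n div 2} - {..<n - n div 2}" for i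
    proof -
      have "i \<le> n" "n - i = i"
        using that by auto
      then show ?thesis
        using v[of i] by simp
    qed
    then show "\<forall>i\<in>{..n div 2} - {..<n - n div 2}. smult (c (n - i)) (v (n - i)) = 0"
      using v by auto
  qed auto
  also have "\<dots> = (\<Sum>i\<le>n div 2. - smult (c (n - i)) (v i))"
    using v by (intro sum.cong) auto
  finally show ?thesis
    by (simp add: smult_diff_left flip: sum.distrib)
qed

definition symmetric_part :: "nat \<Rightarrow> nat \<Rightarrow> real poly \<Rightarrow> real poly" where
  "symmetric_part r n h = (\<Sum>i\<le>Suc n. smult (coeff h i) (centered_sum r n 1 i))"

definition excess_part :: "nat \<Rightarrow> nat \<Rightarrow> real poly \<Rightarrow> real poly" where
  "excess_part r n h =
     (\<Sum>i\<le>Suc n div 2. smult (coeff h (Suc n - i) - coeff h i) (centered_sum r n 0 i))"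

lemma D_op_Suc_eq_parts:
  assumes r: "r > 0"
  shows "D_op (Suc n) r h = symmetric_part r n h + pCons 0 (excess_part r n h)"
proof -
  define S v where "S i = (\<Sum>p<i. section_poly r n p)" and "v i = S i - S (Suc n - i)" for i
  have basis: "section_poly r (Suc n) i = centered_sum r n 1 i + pCons 0 (v i)" if "i \<le> Suc n" for i
    using window_sum_section_poly_eq_centered_sum[OF r that] contract_block[OF that, of 0]
    by (simp add: v_def S_def)
  have centered: "centered_sum r n 0 i = - v i" if "i \<le> Suc n div 2" for i
  proof -
    have "i \<le> Suc n - i"
      using that by auto
    then have "S (Suc n - i) = S i + (\<Sum>p=i..<Suc n - i. section_poly r n p)"
      by (simp add: S_def lessThan_atLeast0 sum.atLeastLessThan_concat)
    then show ?thesis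
      by (simp add: centered_sum_def v_def)
  qed
  have "(\<Sum>i\<le>Suc n. smult (coeff h i) (v i)) =
      (\<Sum>i\<le>Suc n div 2. smult (coeff h i - coeff h (Suc n - i)) (v i))"
    by (rule sum_smult_antisymmetric) (simp add: v_def)
  also have "\<dots> = excess_part r n h"
    unfolding excess_part_def
    by (intro sum.cong refl) (simp add: centered smult_diff_left)
  finally have excess: "(\<Sum>i\<le>Suc n. smult (coeff h i) (v i)) = excess_part r n h" .
  have "D_op (Suc n) r h =
      (\<Sum>i\<le>Suc n. smult (coeff h i) (centered_sum r n 1 i) + pCons 0 (smult (coeff h i) (v i)))"
    unfolding D_op_eq_sum_section_poly[OF r]
    by (intro sum.cong refl) (simp add: basis smult_add_right del: section_poly.simps)
  also have "\<dots> = symmetric_part r n h + pCons 0 (excess_part r n h)"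
    by (simp only: sum.distrib symmetric_part_def pCons_0_sum[symmetric] excess)
  finally show ?thesis .
qed

lemma symmetric_decomposition_D_op_Suc:
  assumes "r > 0"
  shows "symmetric_decomposition (Suc n) (D_op (Suc n) r h)
    (symmetric_part r n h) (excess_part r n h)"
proof -
  have "self_reciprocal (int (n + 1)) (symmetric_part r n h)"
    "self_reciprocal (int (n + 0)) (excess_part r n h)"
    unfolding symmetric_part_def excess_part_def
    by (intro self_reciprocal_sum self_reciprocal_smult self_reciprocal_centered_sum[OF assms])+
  then show ?thesis
    using assms by (simp add: symmetric_decomposition_def D_op_Suc_eq_parts)
qed

lemma nonneg_coeffs_symmetric_part: "nonneg_coeffs h \<Longrightarrow> nonneg_coeffs (symmetric_part r n h)"
  unfolding symmetric_part_def centered_sum_def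
  by (intro nonneg_coeffs_sum nonneg_coeffs_smult nonneg_coeffs_section_poly)
    (simp add: nonneg_coeffs_def)

text \<open>
  A \<open>centered_sum\<close> may extend over more than one period, where interlacing fails; cut at position
  \<open>n + 1\<close> it falls into parts of at most one period each.
\<close>

lemma real_rooted_symmetric_part:
  assumes r: "r > 0" and h: "nonneg_coeffs h"
  shows "real_rooted (symmetric_part r n h)"
proof -
  define N where "N = r * Suc n"
  note cycle = interlacing_cycle_section_poly[OF r, of n, folded N_def]
  have "Suc n \<le> N"
    using r by (cases r) (simp_all add: N_def)
  have coeff_nonneg: "coeff h i \<ge> 0" for i
    using h by (simp add: nonneg_coeffs_def)
  define u where "u = (\<Sum>i\<le>Suc n. smult (coeff h i) (\<Sum>p=i..<Suc n. section_poly r n p))"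
  define w where "w = (\<Sum>i\<le>Suc n. smult (coeff h i) (\<Sum>p=Suc n..<N+Suc n-i. section_poly r n p))"
  have "centered_sum r n 1 i =
      (\<Sum>p=i..<Suc n. section_poly r n p) + (\<Sum>p=Suc n..<N+Suc n-i. section_poly r n p)"
    if "i \<le> Suc n" for i
    unfolding centered_sum_def mult_1 N_def[symmetric] using that \<open>Suc n \<le> N\<close>
    by (intro sum.atLeastLessThan_concat[symmetric]) auto
  then have "symmetric_part r n h = u + w"
    by (simp add: symmetric_part_def u_def w_def smult_add_right flip: sum.distrib)
  moreover have "u \<lless> w"
    unfolding u_def w_def using coeff_nonneg \<open>Suc n \<le> N\<close>
    by (intro interlaces_sum interlaces_smult interlacing_cycle_sums_interlace[OF cycle]) auto
  moreover have "upper_stable u"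
    unfolding u_def using coeff_nonneg \<open>Suc n \<le> N\<close>
    by (intro upper_stable_interlacing_cycle_sums[OF cycle, where a = 0]) auto
  moreover have "upper_stable w"
    unfolding w_def using coeff_nonneg
    by (intro upper_stable_interlacing_cycle_sums[OF cycle, where a = "Suc n"]) auto
  ultimately show ?thesis
    by (simp add: upper_stable_add upper_stable_imp_real_rooted)
qed

definition excess_weight :: "nat \<Rightarrow> real poly \<Rightarrow> nat \<Rightarrow> real" where
  "excess_weight n h p = (\<Sum>i\<le>min p (n - p). coeff h (Suc n - i) - coeff h i)"

lemma excess_weight_nonneg:
  assumes "\<forall>i\<le>Suc n div 2. (\<Sum>j\<le>i. coeff h j) \<le> (\<Sum>j\<le>i. coeff h (Suc n - j))"
  shows "excess_weight n h p \<ge> 0"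
proof -
  have "min p (n - p) \<le> Suc n div 2"
    by linarith
  then show ?thesis
    using assms by (simp add: excess_weight_def sum_subtractf)
qed

lemma excess_part_eq_combination:
  "excess_part r n h = (\<Sum>p\<le>n. smult (excess_weight n h p) (section_poly r n p))"
proof -
  have weight: "(\<Sum>i | i \<le> Suc n div 2 \<and> p \<in> {i..<Suc n - i}. coeff h (Suc n - i) - coeff h i) =
      excess_weight n h p" if "p \<le> n" for p
    unfolding excess_weight_def using that by (intro sum.cong) auto
  have "excess_part r n h = (\<Sum>p\<le>n. smult
      (\<Sum>i | i \<in> {..Suc n div 2} \<and> p \<in> {i..<Suc n - i}. coeff h (Suc n - i) - coeff h i)
      (section_poly r n p))"
    unfolding excess_part_def centered_sum_def mult_0 add_0
    by (rule sum_smult_sum_swap) auto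
  also have "\<dots> = (\<Sum>p\<le>n. smult (excess_weight n h p) (section_poly r n p))"
    by (intro sum.cong refl) (simp only: weight atMost_iff)
  finally show ?thesis .
qed

lemma nonneg_coeffs_excess_part:
  assumes "\<And>p. excess_weight n h p \<ge> 0"
  shows "nonneg_coeffs (excess_part r n h)"
  unfolding excess_part_eq_combination
  by (intro nonneg_coeffs_sum nonneg_coeffs_smult nonneg_coeffs_section_poly assms)

lemma real_rooted_excess_part:
  assumes "r > 0" "\<And>p. excess_weight n h p \<ge> 0"
  shows "real_rooted (excess_part r n h)"
  unfolding excess_part_eq_combination
  by (intro upper_stable_imp_real_rooted upper_stable_section_poly_combination assms)

lemma D_op_0: "r > 0 \<Longrightarrow> D_op 0 r h = [:coeff h 0:]"
  by (simp add: D_op_eq_sum_section_poly)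

lemma symmetric_decomposition_const: "symmetric_decomposition 0 [:c:] [:c:] 0"
  by (simp add: symmetric_decomposition_def self_reciprocal_def)

theorem theorem1p3:
  fixes h :: "real poly" and n r :: nat
  assumes "degree h \<le> n"
    and "nonneg_coeffs h"
    and "r > 0"
  shows "real_rooted (D_op n r h) \<and>
    ((\<forall>i\<le>n div 2. (\<Sum>j\<le>i. coeff h j) \<le> (\<Sum>j\<le>i. coeff h (n - j))) \<longrightarrow>
      (\<exists>a b. symmetric_decomposition n (D_op n r h) a b \<and>
             nonneg_coeffs a \<and> nonneg_coeffs b \<and>
             real_rooted a \<and> real_rooted b))"
proof (intro conjI impI)
  show D: "real_rooted (D_op n r h)"
    by (rule real_rooted_D_op[OF assms(3,2)])
  assume dominance: "\<forall>i\<le>n div 2. (\<Sum>j\<le>i. coeff h j) \<le> (\<Sum>j\<le>i. coeff h (n - j))"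
  show "\<exists>a b. symmetric_decomposition n (D_op n r h) a b \<and> nonneg_coeffs a \<and> nonneg_coeffs b \<and>
      real_rooted a \<and> real_rooted b"
  proof (cases n)
    case 0
    have "nonneg_coeffs [:coeff h 0:]" "nonneg_coeffs 0" "real_rooted 0"
      using assms(2)
      by (simp_all add: nonneg_coeffs_def coeff_pCons real_rooted_def split: nat.split)
    then show ?thesis
      using D symmetric_decomposition_const[of "coeff h 0"] assms(3) by (auto simp: 0 D_op_0)
  next
    case (Suc k)
    have "excess_weight k h p \<ge> 0" for p
      using dominance unfolding Suc by (rule excess_weight_nonneg)
    then show ?thesis
      unfolding Suc using assms(2,3)
      by (intro exI[of _ "symmetric_part r k h"] exI[of _ "excess_part r k h"] conjI
          symmetric_decomposition_D_op_Suc nonneg_coeffs_symmetric_part nonneg_coeffs_excess_part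
          real_rooted_symmetric_part real_rooted_excess_part)
  qed
qed

end
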